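(* Let $h:J\subseteq\mathbb{R}\to\mathbb{R}$ be a nonnegative super-additive function with $h(t)\ge t$ for all $t\in(0,1)$. Let $f:I\subseteq\mathbb{R}\to\mathbb{R}$ be a differentiable mapping on $I^{\circ}$ such that $f'\in L[a,b]$, where $a,b\in I$ with $a<b$. Let $p,q>1$ with $\frac1p+\frac1q=1$. If $|f'|^q$ is an $h$-convex function on $[a,b]$ and $|f'(x)|\le M$ for all $x\in[a,b]$, then for each $x\in[a,b]$ $$\left|f(x)-\frac{1}{b-a}\int_a^b f(u)\,du\right|\le \frac{M\,h^{\frac1q}(1)}{b-a}\left(\int_0^1 h(t^p)\,dt\right)^{\frac1p}\left((x-a)^2+(b-x)^2\right).$$
   Context: $I\subseteq\mathbb{R}$ is an interval, $I^{\circ}$ is its interior, and $L[a,b]$ is the space of Lebesgue integrable functions on $[a,b]$. $J\subseteq\mathbb{R}$ is an interval with $[0,1]\subseteq J$, and $h\not\equiv 0$. $h^{1/q}(1)$ means $(h(1))^{1/q}$. $h:J\to\mathbb{R}$ is super-additive if $h(x+y)\ge h(x)+h(y)$ for all $x,y\in J$ with $x+y\in J$. A function $g$ on an interval $K$ is $h$-convex on $K$ (for a nonnegative $h:J\to\mathbb{R}$, $h\not\equiv0$) if $g$ is nonnegative and $g(tx+(1-t)y)\le h(t)g(x)+h(1-t)g(y)$ for all $x,y\in K$ and $t\in[0,1]$. Hypotheses on the values of $f'$ at points of $[a,b]$ presuppose that $f$ is differentiable there (one-sidedly at an endpoint of $I$). *)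

theory Defs
  imports "HOL-Analysis.Analysis"
begin

definition super_additive_on :: "real set \<Rightarrow> (real \<Rightarrow> real) \<Rightarrow> bool" where
  "super_additive_on J h \<longleftrightarrow> (\<forall>x\<in>J. \<forall>y\<in>J. x + y \<in> J \<longrightarrow> h (x + y) \<ge> h x + h y)"

(* Only the values of h on {0..1} matter here; that h is defined, nonnegative and not
   identically zero on an interval containing {0..1} is assumed where the notion is used. *)
definition h_convex_on :: "(real \<Rightarrow> real) \<Rightarrow> real set \<Rightarrow> (real \<Rightarrow> real) \<Rightarrow> bool" where
  "h_convex_on h K g \<longleftrightarrow>
     (\<forall>x\<in>K. g x \<ge> 0) \<and>
     (\<forall>x\<in>K. \<forall>y\<in>K. \<forall>t\<in>{0..1}. g (t * x + (1 - t) * y) \<le> h t * g x + h (1 - t) * g y)"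

end

theory Submission imports Defs
begin

text \<open>Since \<open>f\<close> is \<open>M\<close>-Lipschitz, Ostrowski's inequality already gives the bound with
  the factor \<open>1/2\<close> in place of \<open>h(1)^(1/q) (\<integral> h(t^p) dt)^(1/p)\<close>. That factor is at least \<open>1/2\<close>:
  super-additivity makes \<open>h\<close> monotone on the unit interval and gives
  \<open>h(1) \<ge> 2 h(1/2) \<ge> 1\<close>, while \<open>\<integral> h(t^p) dt \<ge> \<integral> t^p dt = 1/(p + 1) \<ge> (1/2)^p\<close>.\<close>

lemma has_integral_abs_diff:
  fixes a b x :: real
  assumes "x \<in> {a..b}"
  shows "((\<lambda>u. \<bar>x - u\<bar>) has_integral ((x - a)\<^sup>2 + (b - x)\<^sup>2) / 2) {a..b}"
proof -
  \<comment> \<open>The sign of \<open>x - u\<close> is constant on each side of \<open>x\<close>,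
    so each half has a quadratic antiderivative. The vanishing term \<open>(x - x)\<^sup>2\<close>
    is kept so that the value has the form F(end) - F(start).\<close>
  have left: "((\<lambda>u. x - u) has_integral (- (x - x)\<^sup>2 / 2) - (- (x - a)\<^sup>2 / 2)) {a..x}"
    using assms
    by (intro fundamental_theorem_of_calculus)
       (auto intro!: derivative_eq_intros simp: field_simps
         simp flip: has_real_derivative_iff_has_vector_derivative)
  have right: "((\<lambda>u. u - x) has_integral ((b - x)\<^sup>2 / 2) - ((x - x)\<^sup>2 / 2)) {x..b}"
    using assms
    by (intro fundamental_theorem_of_calculus)
       (auto intro!: derivative_eq_intros simp flip: has_real_derivative_iff_has_vector_derivative)
  have "((\<lambda>u. \<bar>x - u\<bar>) has_integral (x - a)\<^sup>2 / 2) {a..x}"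
    using has_integral_eq[OF _ left, of "\<lambda>u. \<bar>x - u\<bar>"] by simp
  moreover have "((\<lambda>u. \<bar>x - u\<bar>) has_integral (b - x)\<^sup>2 / 2) {x..b}"
    using has_integral_eq[OF _ right, of "\<lambda>u. \<bar>x - u\<bar>"] by simp
  ultimately show ?thesis
    using has_integral_combine[of a x b] assms by (fastforce simp: add_divide_distrib)
qed

text \<open>Up to the factor \<open>b - a\<close>, the deviation from the mean is the integral of
  \<open>f x - f u\<close> over \<open>u\<close>, and \<open>lip\<close> dominates this integrand by
  \<open>M * \<bar>x - u\<bar>\<close>, whose integral is explicit.\<close>

lemma Ostrowski_inequality:
  fixes f :: "real \<Rightarrow> real"
  assumes "a < b" and x: "x \<in> {a..b}" and f: "f integrable_on {a..b}"
    and lip: "\<And>u. u \<in> {a..b} \<Longrightarrow> \<bar>f x - f u\<bar> \<le> M * \<bar>x - u\<bar>"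
  shows "\<bar>f x - 1 / (b - a) * integral {a..b} f\<bar> \<le> M / (b - a) * (((x - a)\<^sup>2 + (b - x)\<^sup>2) / 2)"
proof -
  have dist_int: "((\<lambda>u. M * \<bar>x - u\<bar>) has_integral M * (((x - a)\<^sup>2 + (b - x)\<^sup>2) / 2)) {a..b}"
    by (intro has_integral_mult_right has_integral_abs_diff x)
  have diff_int: "((\<lambda>u. f x - f u) has_integral (b - a) * f x - integral {a..b} f) {a..b}"
    using has_integral_diff[OF has_integral_const_real[of "f x" a b] integrable_integral[OF f]] \<open>a < b\<close>
    by simp
  have "\<bar>(b - a) * f x - integral {a..b} f\<bar> \<le> M * (((x - a)\<^sup>2 + (b - x)\<^sup>2) / 2)"
    using integral_norm_bound_integral[OF has_integral_integrable[OF diff_int]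
        has_integral_integrable[OF dist_int]] lip
    unfolding integral_unique[OF diff_int] integral_unique[OF dist_int] real_norm_def by blast
  then have "\<bar>(b - a) * f x - integral {a..b} f\<bar> / (b - a)
      \<le> M * (((x - a)\<^sup>2 + (b - x)\<^sup>2) / 2) / (b - a)"
    using \<open>a < b\<close> by (intro divide_right_mono) auto
  moreover have "f x - 1 / (b - a) * integral {a..b} f = ((b - a) * f x - integral {a..b} f) / (b - a)"
    using \<open>a < b\<close> by (simp add: field_simps)
  ultimately show ?thesis
    using \<open>a < b\<close> by (simp only: abs_divide abs_of_pos diff_gt_0_iff_gt times_divide_eq_left)
qed

text \<open>Write \<open>2 powr p\<close> as 2 exp((p - 1) ln 2) and use exp y \<ge> 1 + y; the
  slope is sufficient because 2 ln 2 \<ge> 4/3 > 1.\<close>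

lemma add_one_le_two_powr:
  fixes p :: real
  assumes "1 \<le> p"
  shows "p + 1 \<le> 2 powr p"
proof -
  have exp_ge: "2 * y \<le> 2 * (exp y - 1)" for y :: real
    using mult_left_mono[OF exp_ge_add_one_self, of 2 y] by (simp add: algebra_simps)
  have "p - 1 \<le> 2 * ((p - 1) * ln 2)"
    using mult_left_mono[OF ln2_ge_two_thirds, of "p - 1"] assms by simp
  also have "\<dots> \<le> 2 * (exp ((p - 1) * ln 2) - 1)"
    by (rule exp_ge)
  also have "exp ((p - 1) * ln 2) = 2 powr p / 2"
    by (simp add: powr_def left_diff_distrib exp_diff)
  finally show ?thesis by simp
qed

text \<open>Split \<open>t\<close> as \<open>s + (t - s)\<close>: the increment is at least
  \<open>h (t - s)\<close>, which is nonnegative. Monotonicity later supplies the integrability of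
  \<open>h (t powr p)\<close>.\<close>

lemma super_additive_on_imp_mono_on:
  assumes "super_additive_on J h" "{0..1} \<subseteq> J" "\<And>t. t \<in> J \<Longrightarrow> h t \<ge> 0"
  shows "mono_on {0..1} h"
proof (rule mono_onI)
  fix s t :: real
  assume st: "s \<in> {0..1}" "t \<in> {0..1}" "s \<le> t"
  then have "s \<in> J" "t - s \<in> J" "s + (t - s) \<in> J"
    using assms(2) by auto
  then have "h (s + (t - s)) \<ge> h s + h (t - s)" and "h (t - s) \<ge> 0"
    using assms unfolding super_additive_on_def by blast+
  then show "h s \<le> h t" by simp
qed

text \<open>The lower bound on \<open>h\<close> is given only on the open interval; doubling the
  interior point 1/2 carries it to the endpoint 1.\<close>

lemma super_additive_on_ge_one:
  assumes "super_additive_on J h" "{0..1} \<subseteq> J" "\<And>t. t \<in> {0<..<1} \<Longrightarrow> h t \<ge> t"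
  shows "h 1 \<ge> 1"
proof -
  have "1/2 \<in> J" "1/2 + 1/2 \<in> J"
    using assms(2) by auto
  then have "h (1/2 + 1/2) \<ge> h (1/2) + h (1/2)"
    using assms(1) unfolding super_additive_on_def by blast
  then show ?thesis using assms(3)[of "1/2"] by simp
qed

lemma half_le_powr_integral:
  fixes h :: "real \<Rightarrow> real"
  assumes "mono_on {0..1} h" and ge: "\<And>t. t \<in> {0..1} \<Longrightarrow> h t \<ge> t" and "1 \<le> p"
  shows "1 / 2 \<le> (integral {0..1} (\<lambda>t. h (t powr p))) powr (1 / p)"
proof -
  have unit: "t powr p \<in> {0..1}" if "t \<in> {0..1}" for t :: real
    using that assms by (auto intro: powr_le1)
  have "mono_on {0..1} (\<lambda>t. h (t powr p))"
    using assms(3) unit by (intro mono_onI mono_onD[OF assms(1)] powr_mono2) auto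
  \<comment> \<open>Integrability has to be proved before the integrals are compared:
    \<open>integral\<close> is 0 by convention for a non-integrable function, which would break the
    lower bound.\<close>
  then have "(\<lambda>t. h (t powr p)) integrable_on {0..1}"
    by (rule integrable_on_mono_on)
  moreover have powr_int: "((\<lambda>t. t powr p) has_integral 1 / (p + 1)) {0..1}"
    using has_integral_powr_from_0[of p 1] assms(3) by simp
  ultimately have "1 / (p + 1) \<le> integral {0..1} (\<lambda>t. h (t powr p))"
    using integral_le[of "\<lambda>t. t powr p" "{0..1}" "\<lambda>t. h (t powr p)"] ge unit
    by (auto simp: has_integral_iff)
  \<comment> \<open>This weaker bound is chosen because its p-th root is exactly 1/2 for every
    \<open>p\<close>.\<close>
  moreover have "(1 / 2) powr p \<le> 1 / (p + 1)"
    using add_one_le_two_powr[OF assms(3)] assms(3) by (simp add: powr_divide frac_le)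
  ultimately have "((1 / 2) powr p) powr (1 / p) \<le> (integral {0..1} (\<lambda>t. h (t powr p))) powr (1 / p)"
    using assms(3) by (intro powr_mono2) auto
  then show ?thesis
    using assms(3) by (simp add: powr_powr)
qed

theorem theorem3:
  fixes I J :: "real set" and h f f' :: "real \<Rightarrow> real" and a b p q M :: real
  assumes J_interval: "is_interval J" and J_unit: "{0..1} \<subseteq> J"
    and h_nonneg: "\<And>t. t \<in> J \<Longrightarrow> h t \<ge> 0"
    and h_nonzero: "\<exists>t\<in>J. h t \<noteq> 0"
    and h_super: "super_additive_on J h"
    and h_ge: "\<And>t. t \<in> {0<..<1} \<Longrightarrow> h t \<ge> t"
    and I_interval: "is_interval I"
    and ab: "a \<in> I" "b \<in> I" "a < b"
    and deriv_interior: "\<And>x. x \<in> interior I \<Longrightarrow> (f has_real_derivative f' x) (at x)"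
    and deriv_ab: "\<And>x. x \<in> {a..b} \<Longrightarrow> (f has_real_derivative f' x) (at x within I)"
    and f'_L1: "f' absolutely_integrable_on {a..b}"
    and pq: "p > 1" "q > 1" "1 / p + 1 / q = 1"
    and conv: "h_convex_on h {a..b} (\<lambda>x. \<bar>f' x\<bar> powr q)"
    and bound: "\<And>x. x \<in> {a..b} \<Longrightarrow> \<bar>f' x\<bar> \<le> M"
  shows "\<forall>x\<in>{a..b}.
    \<bar>f x - 1 / (b - a) * integral {a..b} f\<bar>
      \<le> M * h 1 powr (1 / q) / (b - a)
          * (integral {0..1} (\<lambda>t. h (t powr p))) powr (1 / p)
          * ((x - a)\<^sup>2 + (b - x)\<^sup>2)"
proof
  fix x assume x: "x \<in> {a..b}"
  have "{a..b} \<subseteq> I"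
    using I_interval ab by (meson atLeastAtMost_iff is_interval_1 subsetI)
  \<comment> \<open>At \<open>a\<close> and \<open>b\<close> these derivatives are one-sided; this
    form serves both the continuity of \<open>f\<close> and the mean value bound on the closed
    interval.\<close>
  then have deriv: "(f has_real_derivative f' u) (at u within {a..b})" if "u \<in> {a..b}" for u
    using deriv_ab[OF that] by (rule DERIV_subset[rotated])
  have "continuous_on {a..b} f"
    using deriv by (intro DERIV_continuous_on) auto
  then have "f integrable_on {a..b}"
    by (rule integrable_continuous_real)
  moreover have "\<bar>f x - f u\<bar> \<le> M * \<bar>x - u\<bar>" if "u \<in> {a..b}" for u
    using field_differentiable_bound[of "{a..b}" f f' M x u] deriv bound x that
    by simp
  ultimately have ostrowski: "\<bar>f x - 1 / (b - a) * integral {a..b} f\<bar>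
      \<le> M / (b - a) * (((x - a)\<^sup>2 + (b - x)\<^sup>2) / 2)"
    using x ab by (intro Ostrowski_inequality)
  have h1: "h 1 \<ge> 1"
    using super_additive_on_ge_one[OF h_super J_unit h_ge] .
  \<comment> \<open>The endpoints are separate cases: 0 follows from nonnegativity and 1 from
    \<open>h1\<close>.\<close>
  have "h t \<ge> t" if "t \<in> {0..1}" for t
    using that h1 h_ge[of t] h_nonneg[of 0] subsetD[OF J_unit, of 0]
    by (cases "t = 0"; cases "t = 1") auto
  then have "1 / 2 \<le> (integral {0..1} (\<lambda>t. h (t powr p))) powr (1 / p)"
    using super_additive_on_imp_mono_on[OF h_super J_unit h_nonneg] pq
    by (intro half_le_powr_integral) auto
  moreover have "1 \<le> h 1 powr (1 / q)"
    using h1 pq by (intro ge_one_powr_ge_zero) auto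
  \<comment> \<open>The left side is written as a product so that the two lower bounds multiply
    factor by factor.\<close>
  ultimately have factor: "1 * (1 / 2) \<le> h 1 powr (1 / q) * (integral {0..1} (\<lambda>t. h (t powr p))) powr (1 / p)"
    by (intro mult_mono) auto
  have "0 \<le> M"
    using bound[OF x] by linarith
  \<comment> \<open>Multiplying \<open>factor\<close> by this nonnegative quantity replaces the 1/2
    in \<open>ostrowski\<close> by the required constant.\<close>
  then have "0 \<le> M / (b - a) * ((x - a)\<^sup>2 + (b - x)\<^sup>2)"
    using ab by simp
  from mult_left_mono[OF factor this] ostrowski
  show "\<bar>f x - 1 / (b - a) * integral {a..b} f\<bar>
      \<le> M * h 1 powr (1 / q) / (b - a)
          * (integral {0..1} (\<lambda>t. h (t powr p))) powr (1 / p)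
          * ((x - a)\<^sup>2 + (b - x)\<^sup>2)"
    by (simp add: mult_ac)
qed

end
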